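(* Let $n$ be a positive integer. A lattice model whose vertices have the Boltzmann weights $L_x(p,\Sigma,q,\Sigma')$ listed in the context is solvable. That is, there exists a non-zero Boltzmann weight function $R_{a,b}^{c,d}(x_i,x_j)$ ($a,b,c,d\in\{+,1,\ldots,n\}$) for the $R$-vertices, depending on the spectral parameters $x_i,x_j$, such that for all $a,b,c,d\in\{+,1,\ldots,n\}$ and all $\Sigma,\Sigma'\subseteq\{1,\ldots,n\}$, $$\sum_{e,f,\Sigma''}R_{a,b}^{e,f}(x_i,x_j)\,L_{x_i}(e,\Sigma,c,\Sigma'')\,L_{x_j}(f,\Sigma'',d,\Sigma')=\sum_{e,f,\Sigma''}L_{x_j}(b,\Sigma,e,\Sigma'')\,L_{x_i}(a,\Sigma'',f,\Sigma')\,R_{f,e}^{c,d}(x_i,x_j),$$ where the sums are over $e,f\in\{+,1,\ldots,n\}$ and $\Sigma''\subseteq\{1,\ldots,n\}$.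
   Context: $\alpha,\beta,\gamma$ are parameters. Horizontal edges carry labels in $\{+,1,\ldots,n\}$ and vertical edges carry subsets of $\{1,\ldots,n\}$ as labels. $L_x(p,\Sigma,q,\Sigma')$ is the Boltzmann weight of a vertex with (west, north, east, south) labels $(p,\Sigma,q,\Sigma')$ in a row with spectral parameter $x$. $R_{a,b}^{c,d}(x_i,x_j)$ is the weight of an $R$-vertex with (southwest, northwest, northeast, southeast) labels $(a,b,c,d)$. The two sides of the displayed identity are the partition functions of the two three-vertex diagrams in the Yang--Baxter equation with boundary condition $(a,b,\Sigma,c,d,\Sigma')$. Let $h_k=h_k(\alpha,\beta)$ be the complete homogeneous symmetric polynomial of degree $k$ in $\alpha,\beta$, with $h_{-1}=0$ and $h_{-2}=-1/(\alpha\beta)$ (so $\alpha\beta h_{-2}=-1$), and for $\Sigma\subseteq\{1,\ldots,n\}$ let $\Sigma_{>c}=\{s\in\Sigma: s\ge c+1\}$. For colors $c,d\in\{1,\ldots,n\}$ the weights are: (1) $L_x(+,\Sigma,+,\Sigma)=(-1)^{|\Sigma|+1}\big(((\alpha+\gamma)(\beta+\gamma)x+\gamma)h_{|\Sigma|-1}+\alpha\beta h_{|\Sigma|-2}\big)$. (2) $L_x(c,\Sigma,c,\Sigma)=(1+(\alpha+\beta+\gamma)x)(\alpha\beta)^{|\Sigma_{>c}|}$ if $c\in\Sigma$, and $x(\alpha\beta)^{|\Sigma_{>c}|}$ if $c\notin\Sigma$. (3) $L_x(+,\Sigma,c,\Sigma\cup\{c\})=(-\alpha)^{|\Sigma_{>c}|}(1+(\alpha+\gamma)x)(1+(\beta+\gamma)x)$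 for $c\notin\Sigma$. (4) $L_x(c,\Sigma,+,\Sigma\setminus\{c\})=(-1)^{|\Sigma|}(-\beta)^{|\Sigma_{>c}|}(\alpha\beta h_{|\Sigma|-3}+\gamma h_{|\Sigma|-2})$ for $c\in\Sigma$. (5) $L_x(c,\Sigma,d,(\Sigma\cup\{d\})\setminus\{c\})=(-\alpha)^{|\Sigma_{>d}|}(-\beta)^{|\Sigma_{>c}|}(1+(\alpha+\gamma)x)$ for $c<d$, $c\in\Sigma$, $d\notin\Sigma$. (6) $L_x(d,\Sigma,c,\Sigma')=(-\alpha)^{|\Sigma'_{>c}|}(-\beta)^{|\Sigma_{>d}|}(1+(\beta+\gamma)x)$ with $\Sigma'=(\Sigma\cup\{c\})\setminus\{d\}$, for $c<d$, $d\in\Sigma$, $c\notin\Sigma$. All other values of $L_x$ are $0$. *)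

theory Defs
  imports Main
begin

datatype hlabel = Plus | Col nat

definition hlabels :: "nat \<Rightarrow> hlabel set" where
  "hlabels n = insert Plus (Col ` {1..n})"

definition above :: "nat set \<Rightarrow> nat \<Rightarrow> nat set" where
  "above S c = {s \<in> S. s \<ge> c + 1}"

definition chom :: "'a::field \<Rightarrow> 'a \<Rightarrow> int \<Rightarrow> 'a" where
  "chom \<alpha> \<beta> k =
     (if k = -2 then - 1 / (\<alpha> * \<beta>)
      else if k < 0 then 0
      else (\<Sum>i\<le>nat k. \<alpha> ^ i * \<beta> ^ (nat k - i)))"

text \<open>
  The product \<open>\<alpha> \<beta> h\<^sub>k\<close>.  In the weights \<open>h\<close> is evaluated at -2 only inside this
  product, where its value is -1.  Making that value explicit keeps the convention valid when
  \<open>\<alpha> \<beta> = 0\<close>, where HOL's division by zero would give 0 instead.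
\<close>

definition ab_chom :: "'a::field \<Rightarrow> 'a \<Rightarrow> int \<Rightarrow> 'a" where
  "ab_chom \<alpha> \<beta> k = (if k = -2 then - 1 else \<alpha> * \<beta> * chom \<alpha> \<beta> k)"

lemma ab_chom_eq:
  assumes "\<alpha> \<noteq> 0" and "\<beta> \<noteq> 0"
  shows "ab_chom \<alpha> \<beta> k = \<alpha> * \<beta> * chom \<alpha> \<beta> k"
  using assms by (simp add: ab_chom_def chom_def)

text \<open>
  The arguments of \<open>Lweight \<alpha> \<beta> \<gamma> x p S q T\<close> after \<open>x\<close> are the west, north, east and south
  labels.
\<close>

definition Lweight ::
  "'a::field \<Rightarrow> 'a \<Rightarrow> 'a \<Rightarrow> 'a \<Rightarrow> hlabel \<Rightarrow> nat set \<Rightarrow> hlabel \<Rightarrow> nat set \<Rightarrow> 'a" where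
  "Lweight \<alpha> \<beta> \<gamma> x p S q T =
    (case p of
       Plus \<Rightarrow>
         (case q of
            Plus \<Rightarrow>
              (if T = S
               then (-1) ^ (card S + 1) *
                    (((\<alpha> + \<gamma>) * (\<beta> + \<gamma>) * x + \<gamma>) * chom \<alpha> \<beta> (int (card S) - 1)
                     + ab_chom \<alpha> \<beta> (int (card S) - 2))
               else 0)
          | Col c \<Rightarrow>
              (if c \<notin> S \<and> T = S \<union> {c}
               then (- \<alpha>) ^ card (above S c) * (1 + (\<alpha> + \<gamma>) * x) * (1 + (\<beta> + \<gamma>) * x)
               else 0))
     | Col c \<Rightarrow>
         (case q of
            Plus \<Rightarrow>
              (if c \<in> S \<and> T = S - {c}
               then (-1) ^ card S * (- \<beta>) ^ card (above S c) *
                    (ab_chom \<alpha> \<beta> (int (card S) - 3) + \<gamma> * chom \<alpha> \<beta> (int (card S) - 2))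
               else 0)
          | Col d \<Rightarrow>
              (if c = d then
                 (if T = S
                  then (if c \<in> S then 1 + (\<alpha> + \<beta> + \<gamma>) * x else x)
                       * (\<alpha> * \<beta>) ^ card (above S c)
                  else 0)
               else if c \<in> S \<and> d \<notin> S \<and> T = (S \<union> {d}) - {c} then
                 (if c < d
                  then (- \<alpha>) ^ card (above S d) * (- \<beta>) ^ card (above S c) * (1 + (\<alpha> + \<gamma>) * x)
                  else (- \<alpha>) ^ card (above T d) * (- \<beta>) ^ card (above S c) * (1 + (\<beta> + \<gamma>) * x))
               else 0)))"

text \<open>
  \<open>L x p S q T\<close> is the weight of an ordinary vertex with (west, north, east, south) labels
  \<open>p, S, q, T\<close>, and \<open>R x y a b c d\<close> is the weight \<open>R\<^bsub>a,b\<^esub>\<^bsup>c,d\<^esup>(x, y)\<close> of an R-vertex with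
  (southwest, northwest, northeast, southeast) labels \<open>a, b, c, d\<close>.  The R-vertex is on the left
  in \<open>ybe_lhs\<close> and on the right in \<open>ybe_rhs\<close>.
\<close>

definition ybe_lhs ::
  "nat \<Rightarrow> ('a \<Rightarrow> hlabel \<Rightarrow> nat set \<Rightarrow> hlabel \<Rightarrow> nat set \<Rightarrow> 'a)
   \<Rightarrow> ('a \<Rightarrow> 'a \<Rightarrow> hlabel \<Rightarrow> hlabel \<Rightarrow> hlabel \<Rightarrow> hlabel \<Rightarrow> 'a)
   \<Rightarrow> 'a \<Rightarrow> 'a \<Rightarrow> hlabel \<Rightarrow> hlabel \<Rightarrow> nat set \<Rightarrow> hlabel \<Rightarrow> hlabel \<Rightarrow> nat set \<Rightarrow> 'a::field" where
  "ybe_lhs n L R x y a b S c d T =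
    (\<Sum>e\<in>hlabels n. \<Sum>f\<in>hlabels n. \<Sum>U\<in>Pow {1..n}.
       R x y a b e f * L x e S c U * L y f U d T)"

definition ybe_rhs ::
  "nat \<Rightarrow> ('a \<Rightarrow> hlabel \<Rightarrow> nat set \<Rightarrow> hlabel \<Rightarrow> nat set \<Rightarrow> 'a)
   \<Rightarrow> ('a \<Rightarrow> 'a \<Rightarrow> hlabel \<Rightarrow> hlabel \<Rightarrow> hlabel \<Rightarrow> hlabel \<Rightarrow> 'a)
   \<Rightarrow> 'a \<Rightarrow> 'a \<Rightarrow> hlabel \<Rightarrow> hlabel \<Rightarrow> nat set \<Rightarrow> hlabel \<Rightarrow> hlabel \<Rightarrow> nat set \<Rightarrow> 'a::field" where
  "ybe_rhs n L R x y a b S c d T =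
    (\<Sum>e\<in>hlabels n. \<Sum>f\<in>hlabels n. \<Sum>U\<in>Pow {1..n}.
       L y b S e U * L x a U f T * R x y f e c d)"

text \<open>
  The R-weights are required to be not all zero at every pair of spectral parameters.  Asking only
  that \<open>R\<close> be not identically zero as a function of \<open>(x, y)\<close> would be vacuous: for \<open>x = y\<close> the
  R-weights that are 1 if \<open>a = d\<close> and \<open>b = c\<close>, and 0 otherwise, always solve the equation.
\<close>

definition solvable ::
  "nat \<Rightarrow> ('a \<Rightarrow> hlabel \<Rightarrow> nat set \<Rightarrow> hlabel \<Rightarrow> nat set \<Rightarrow> 'a::field) \<Rightarrow> bool" where
  "solvable n L \<longleftrightarrow>
    (\<exists>R :: 'a \<Rightarrow> 'a \<Rightarrow> hlabel \<Rightarrow> hlabel \<Rightarrow> hlabel \<Rightarrow> hlabel \<Rightarrow> 'a.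
       \<forall>x y.
         (\<exists>a\<in>hlabels n. \<exists>b\<in>hlabels n. \<exists>c\<in>hlabels n. \<exists>d\<in>hlabels n. R x y a b c d \<noteq> 0) \<and>
         (\<forall>a\<in>hlabels n. \<forall>b\<in>hlabels n. \<forall>c\<in>hlabels n. \<forall>d\<in>hlabels n.
            \<forall>S\<in>Pow {1..n}. \<forall>T\<in>Pow {1..n}.
              ybe_lhs n L R x y a b S c d T = ybe_rhs n L R x y a b S c d T))"

end

theory Submission
  imports Defs
begin

text \<open>
  A vertex with west label \<open>p\<close> and east label \<open>q\<close> removes the colour \<open>p\<close> from the column set and then
  adds the colour \<open>q\<close>, where \<open>+\<close> stands for no colour and a vertex with \<open>p = q\<close> leaves the set alone.
  Hence the south label is determined by the other three, and colours are conserved.  Let the R-vertex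
  be non-zero only if the two labels on its right are those on its left, either passed straight through
  (weight \<open>\<pi>\<close>) or swapped (weight \<open>\<kappa>\<close>).  Then both sides of the Yang--Baxter equation consist of two
  terms, and by conservation all four of these, where non-zero, lead from \<open>\<Sigma>\<close> to the same \<open>\<Sigma>'\<close>
  (\<open>south_south_iff\<close>, \<open>ybe_if_exchange\<close>).  Writing \<open>W(p \<rightarrow> q, p' \<rightarrow> q')\<close> for the weight of two stacked
  vertices, the upper one first, with the spectral parameters as indices, what is left is

    \<open>\<pi>(a,b) W\<^bsub>x,y\<^esub>(a \<rightarrow> c, b \<rightarrow> d) + \<kappa>(a,b) W\<^bsub>x,y\<^esub>(b \<rightarrow> c, a \<rightarrow> d)
     = \<pi>(c,d) W\<^bsub>y,x\<^esub>(b \<rightarrow> d, a \<rightarrow> c) + \<kappa>(d,c) W\<^bsub>y,x\<^esub>(b \<rightarrow> c, a \<rightarrow> d)\<close>,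

  called \<open>exchange\<close> below.

  This equation is local.  At most four colours occur in it.  Let \<open>B\<close> consist of the other
  colours in the column, so that every set that occurs is \<open>B\<close> together with some of these four.  Then
  \<open>B\<close> enters the weights only through its size and through the powers of \<open>-\<alpha>\<close> and \<open>-\<beta>\<close> that count
  its elements above one of the four colours.  When an element is added, such a power is multiplied by
  \<open>-\<alpha>\<close>, by \<open>-\<beta>\<close> or by 1 (\<open>above_power_insert\<close>).  The size \<open>m\<close> enters through the pair
  \<open>((-1)\<^sup>m h\<^bsub>m-1\<^esub>, (-1)\<^sup>m \<alpha>\<beta> h\<^bsub>m-2\<^esub>)\<close>, which undergoes a fixed linear map when \<open>m\<close> grows by
  one (\<open>alt_h_Suc\<close>, \<open>alt_abh_Suc\<close>); the convention \<open>\<alpha>\<beta> h\<^bsub>-2\<^esub> = -1\<close> makes this true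
  from \<open>m = 0\<close> on.  So the powers and the pair at \<open>B\<close> can be treated as indeterminates, and for each
  relative order of the colours and each choice of those present in the column the exchange
  equation becomes a polynomial identity with integer coefficients.

  The weights \<open>\<pi>\<close> and \<open>\<kappa>\<close> that satisfy all these identities are \<open>pass_weight\<close> and \<open>swap_weight\<close>.  Since
  \<open>\<pi>(+,c) = y - x\<close> for every colour \<open>c\<close>, this R-vertex does not vanish for \<open>x \<noteq> y\<close>.  For \<open>x = y\<close> it
  may, but then the R-vertex that always swaps turns both sides of the equation into the same product.
\<close>

section \<open>How the weights depend on the column set\<close>

definition above_power :: "'a::field \<Rightarrow> nat \<Rightarrow> nat set \<Rightarrow> 'a" where
  "above_power t k S = (- t) ^ card (above S k)"

lemma above_power_insert:
  assumes "finite S" "s \<notin> S"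
  shows "above_power t k (insert s S) = (if k < s then - t * above_power t k S else above_power t k S)"
proof -
  have "above (insert s S) k = (if k < s then insert s (above S k) else above S k)"
    by (auto simp: above_def)
  moreover have "s \<notin> above S k" "finite (above S k)"
    using assms by (auto simp: above_def)
  ultimately show ?thesis by (simp add: above_power_def)
qed

text \<open>
  The signs \<open>(-1)\<^sup>m\<close> are absorbed because they alternate along with the size of the column set.
  The index shifts are those for which the vertices with east label \<open>+\<close> take both sequences at the
  size of the column set left after the west colour has been removed.
\<close>

definition alt_h :: "'a::field \<Rightarrow> 'a \<Rightarrow> nat \<Rightarrow> 'a" where
  "alt_h \<alpha> \<beta> m = (-1) ^ m * chom \<alpha> \<beta> (int m - 1)"

definition alt_abh :: "'a::field \<Rightarrow> 'a \<Rightarrow> nat \<Rightarrow> 'a" where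
  "alt_abh \<alpha> \<beta> m = (-1) ^ m * ab_chom \<alpha> \<beta> (int m - 2)"

lemma alt_abh_Suc: "alt_abh \<alpha> \<beta> (Suc m) = - (\<alpha> * \<beta> * alt_h \<alpha> \<beta> m)"
  by (simp add: alt_abh_def alt_h_def ab_chom_def)

lemma chom_rec:
  "chom \<alpha> \<beta> (int (Suc (Suc m))) = (\<alpha> + \<beta>) * chom \<alpha> \<beta> (int (Suc m)) - \<alpha> * \<beta> * chom \<alpha> \<beta> (int m)"
proof -
  have step: "chom \<alpha> \<beta> (int (Suc k)) = \<alpha> ^ Suc k + \<beta> * chom \<alpha> \<beta> (int k)" for k
    by (simp add: chom_def sum_distrib_left Suc_diff_le nat_add_distrib algebra_simps)
  show ?thesis unfolding step by (simp add: algebra_simps)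
qed

text \<open>
  The three-term recursion of \<open>h\<close>, extended to the left end of the sequence: the first two instances
  \<open>m = 0\<close> and \<open>m = 1\<close> read \<open>h\<^sub>0 = - \<alpha>\<beta> h\<^bsub>-2\<^esub>\<close> and \<open>h\<^sub>1 = \<alpha> + \<beta>\<close>.
\<close>

lemma alt_h_Suc: "alt_h \<alpha> \<beta> (Suc m) = alt_abh \<alpha> \<beta> m - (\<alpha> + \<beta>) * alt_h \<alpha> \<beta> m"
proof (cases m)
  case (Suc k)
  show ?thesis
  proof (cases k)
    case 0
    with Suc show ?thesis by (simp add: alt_h_def alt_abh_def ab_chom_def chom_def algebra_simps)
  next
    case (Suc j)
    have "alt_h \<alpha> \<beta> (Suc m) = (-1) ^ Suc m * chom \<alpha> \<beta> (int (Suc (Suc j)))"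
      using \<open>m = Suc k\<close> Suc by (simp add: alt_h_def)
    also have "\<dots> = (-1) ^ m * (\<alpha> * \<beta> * chom \<alpha> \<beta> (int j)) - (\<alpha> + \<beta>) * ((-1) ^ m * chom \<alpha> \<beta> (int (Suc j)))"
      unfolding chom_rec by (simp add: algebra_simps)
    finally show ?thesis
      using \<open>m = Suc k\<close> Suc by (simp add: alt_h_def alt_abh_def ab_chom_def)
  qed
qed (simp add: alt_h_def alt_abh_def ab_chom_def chom_def)

section \<open>Vertices as annihilation followed by creation\<close>

text \<open>
  The weight of a vertex with its south label left out.  All powers are taken over the set
  \<open>S - {p}\<close> that remains after the west colour is annihilated and before the east colour is created.
  In this form the cases \<open>p < q\<close> and \<open>p > q\<close> of a vertex with two distinct colours differ only in the
  choice of \<open>\<alpha>\<close> or \<open>\<beta>\<close> in the factor that contains \<open>x\<close>.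
\<close>

fun vertex_weight :: "'a::field \<Rightarrow> 'a \<Rightarrow> 'a \<Rightarrow> 'a \<Rightarrow> hlabel \<Rightarrow> nat set \<Rightarrow> hlabel \<Rightarrow> 'a" where
  "vertex_weight \<alpha> \<beta> \<gamma> x Plus S Plus =
     - (((\<alpha> + \<gamma>) * (\<beta> + \<gamma>) * x + \<gamma>) * alt_h \<alpha> \<beta> (card S) + alt_abh \<alpha> \<beta> (card S))"
| "vertex_weight \<alpha> \<beta> \<gamma> x Plus S (Col q) =
     (if q \<in> S then 0 else above_power \<alpha> q S * ((1 + (\<alpha> + \<gamma>) * x) * (1 + (\<beta> + \<gamma>) * x)))"
| "vertex_weight \<alpha> \<beta> \<gamma> x (Col p) S Plus =
     (if p \<in> S then
        - (above_power \<beta> p (S - {p})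
           * (\<gamma> * alt_h \<alpha> \<beta> (card (S - {p})) + alt_abh \<alpha> \<beta> (card (S - {p}))))
      else 0)"
| "vertex_weight \<alpha> \<beta> \<gamma> x (Col p) S (Col q) =
     (if p = q then
        (if p \<in> S then 1 + (\<alpha> + \<beta> + \<gamma>) * x else x)
        * (above_power \<alpha> p (S - {p}) * above_power \<beta> p (S - {p}))
      else if p \<in> S \<and> q \<notin> S then
        (1 + ((if p < q then \<alpha> else \<beta>) + \<gamma>) * x)
        * (above_power \<beta> p (S - {p}) * above_power \<alpha> q (S - {p}))
      else 0)"

fun south :: "hlabel \<Rightarrow> nat set \<Rightarrow> hlabel \<Rightarrow> nat set" where
  "south Plus S Plus = S"
| "south Plus S (Col q) = insert q S"
| "south (Col p) S Plus = S - {p}"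
| "south (Col p) S (Col q) = (if p = q then S else insert q (S - {p}))"

lemma Lweight_eq_vertex_weight:
  assumes "finite S"
  shows "Lweight \<alpha> \<beta> \<gamma> x p S q T =
    (if T = south p S q then vertex_weight \<alpha> \<beta> \<gamma> x p S q else 0)"
proof -
  have above_Diff: "above (S - {c}) c = above S c" for c
    by (auto simp: above_def)
  have above_T: "above (insert d (S - {c})) d = above (S - {c}) d" for c d
    by (auto simp: above_def)
  have above_low: "above (S - {c}) d = above S d" if "c < d" for c d
    using that by (auto simp: above_def)
  have neg_pow: "(- \<alpha>) ^ k * (- \<beta>) ^ k = (\<alpha> * \<beta>) ^ k" for k
    by (simp flip: power_mult_distrib)
  show ?thesis
  proof (cases p; cases q)
    fix c d
    assume "p = Col c" "q = Col d"
    then show ?thesis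
      by (cases c d rule: linorder_cases)
        (auto simp: Lweight_def above_power_def above_Diff above_T above_low neg_pow insert_Diff_if)
  next
    fix c
    assume "p = Col c" "q = Plus"
    moreover have "card S = Suc (card (S - {c}))" if "c \<in> S"
      using assms that by (rule card.remove)
    ultimately show ?thesis
      by (cases "c \<in> S")
        (simp_all add: Lweight_def above_power_def above_Diff alt_h_def alt_abh_def algebra_simps
          del: card_Diff_insert card_Diff_singleton)
  qed (auto simp: Lweight_def above_power_def alt_h_def alt_abh_def algebra_simps)
qed

definition column_weight ::
  "'a::field \<Rightarrow> 'a \<Rightarrow> 'a \<Rightarrow> nat set \<Rightarrow> 'a \<Rightarrow> hlabel \<Rightarrow> hlabel
    \<Rightarrow> 'a \<Rightarrow> hlabel \<Rightarrow> hlabel \<Rightarrow> 'a" where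
  "column_weight \<alpha> \<beta> \<gamma> S x p q y p' q' =
     vertex_weight \<alpha> \<beta> \<gamma> x p S q * vertex_weight \<alpha> \<beta> \<gamma> y p' (south p S q) q'"

section \<open>Conservation of colours\<close>

text \<open>
  Colours on the north and east side, counted with multiplicity, against those on the south
  and west side.  Counting makes the condition symmetric in the two west labels and in the two east
  labels, which a description of \<open>T\<close> as a sequence of insertions and deletions would hide.
\<close>

definition balanced :: "nat set \<Rightarrow> hlabel \<Rightarrow> hlabel \<Rightarrow> hlabel \<Rightarrow> hlabel \<Rightarrow> nat set \<Rightarrow> bool" where
  "balanced S a b c d T \<longleftrightarrow>
     (\<forall>k. of_bool (k \<in> S) + of_bool (c = Col k) + of_bool (d = Col k)
        = (of_bool (k \<in> T) + of_bool (a = Col k) + of_bool (b = Col k) :: nat))"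

lemma balanced_commute:
  "balanced S b a c d T = balanced S a b c d T"
  "balanced S a b d c T = balanced S a b c d T"
  by (simp_all add: balanced_def ac_simps)

lemma balanced_if_vertex:
  assumes "vertex_weight \<alpha> \<beta> \<gamma> x p S q \<noteq> 0"
  shows "of_bool (k \<in> S) + of_bool (q = Col k) = (of_bool (k \<in> south p S q) + of_bool (p = Col k) :: nat)"
  using assms by (cases p; cases q) (auto split: if_splits)

lemma south_south_iff:
  assumes "column_weight \<alpha> \<beta> \<gamma> S x p q y p' q' \<noteq> 0"
  shows "T = south p' (south p S q) q' \<longleftrightarrow> balanced S p p' q q' T"
proof -
  let ?U = "south p S q" and ?V = "south p' (south p S q) q'"
  have "vertex_weight \<alpha> \<beta> \<gamma> x p S q \<noteq> 0" "vertex_weight \<alpha> \<beta> \<gamma> y p' ?U q' \<noteq> 0"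
    using assms by (auto simp only: column_weight_def mult_eq_0_iff)
  note colours = this[THEN balanced_if_vertex]
  have "balanced S p p' q q' T \<longleftrightarrow> (\<forall>k. of_bool (k \<in> T) = (of_bool (k \<in> ?V) :: nat))"
    unfolding balanced_def
  proof (intro iff_allI)
    fix k
    show "(of_bool (k \<in> S) + of_bool (q = Col k) + of_bool (q' = Col k)
        = (of_bool (k \<in> T) + of_bool (p = Col k) + of_bool (p' = Col k) :: nat))
      \<longleftrightarrow> (of_bool (k \<in> T) = (of_bool (k \<in> ?V) :: nat))"
      using colours[of k] by linarith
  qed
  also have "\<dots> \<longleftrightarrow> T = ?V"
    by (auto simp: of_bool_eq_iff)
  finally show ?thesis by simp
qed

text \<open>
  The only column set \<open>U\<close> that contributes is the south label of the upper vertex.  With \<open>balanced\<close> the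
  condition on \<open>T\<close> does not depend on which of the two vertices carries which labels.
\<close>

lemma column_sum:
  fixes \<alpha> \<beta> \<gamma> x y :: "'a::field"
  assumes "S \<subseteq> {1..n}" "p \<in> hlabels n" "q \<in> hlabels n"
  shows "(\<Sum>U\<in>Pow {1..n}. Lweight \<alpha> \<beta> \<gamma> x p S q U * Lweight \<alpha> \<beta> \<gamma> y p' U q' T)
    = (if balanced S p p' q q' T then column_weight \<alpha> \<beta> \<gamma> S x p q y p' q' else 0)"
proof -
  have U: "south p S q \<in> Pow {1..n}"
    using assms by (cases p; cases q) (auto simp: hlabels_def)
  have fin: "finite U" if "U \<subseteq> {1..n}" for U
    using that finite_subset by blast
  have "(\<Sum>U\<in>Pow {1..n}. Lweight \<alpha> \<beta> \<gamma> x p S q U * Lweight \<alpha> \<beta> \<gamma> y p' U q' T)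
    = (\<Sum>U\<in>Pow {1..n}. if U = south p S q
        then vertex_weight \<alpha> \<beta> \<gamma> x p S q * Lweight \<alpha> \<beta> \<gamma> y p' U q' T else 0)"
    by (rule sum.cong) (simp_all add: Lweight_eq_vertex_weight fin[OF assms(1)])
  also have "\<dots> = vertex_weight \<alpha> \<beta> \<gamma> x p S q * Lweight \<alpha> \<beta> \<gamma> y p' (south p S q) q' T"
    using U by simp
  also have "\<dots> = (if T = south p' (south p S q) q' then column_weight \<alpha> \<beta> \<gamma> S x p q y p' q' else 0)"
    using U by (simp add: Lweight_eq_vertex_weight fin column_weight_def)
  also have "\<dots> = (if balanced S p p' q q' T then column_weight \<alpha> \<beta> \<gamma> S x p q y p' q' else 0)"
    using south_south_iff by metis
  finally show ?thesis .
qed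

section \<open>Reduction to the exchange equation\<close>

text \<open>
  The R-vertex in which the labels pass through with weight \<open>\<pi>\<close> and are swapped with weight \<open>\<kappa>\<close>.
  For equal labels \<open>a = b\<close> both happen at once and the two weights add up.
\<close>

definition pass_swap_R :: "(hlabel \<Rightarrow> hlabel \<Rightarrow> 'a) \<Rightarrow> (hlabel \<Rightarrow> hlabel \<Rightarrow> 'a) \<Rightarrow>
    hlabel \<Rightarrow> hlabel \<Rightarrow> hlabel \<Rightarrow> hlabel \<Rightarrow> 'a::field" where
  "pass_swap_R \<pi> \<kappa> a b c d =
     (if c = a \<and> d = b then \<pi> a b else 0) + (if c = b \<and> d = a then \<kappa> a b else 0)"

lemma sum_pass_swap_R:
  fixes \<pi> \<kappa> F :: "hlabel \<Rightarrow> hlabel \<Rightarrow> 'a::field"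
  assumes H: "finite H" "a \<in> H" "b \<in> H"
  shows "(\<Sum>e\<in>H. \<Sum>f\<in>H. pass_swap_R \<pi> \<kappa> a b e f * F e f) = \<pi> a b * F a b + \<kappa> a b * F b a"
    and "(\<Sum>e\<in>H. \<Sum>f\<in>H. F e f * pass_swap_R \<pi> \<kappa> f e a b) = \<pi> a b * F b a + \<kappa> b a * F a b"
proof -
  have delta: "(\<Sum>e\<in>H. \<Sum>f\<in>H. if e = u \<and> f = v then w else 0) = w"
    if "u \<in> H" "v \<in> H" for u v and w :: 'a
  proof -
    have "(\<Sum>f\<in>H. if e = u \<and> f = v then w else 0) = (if e = u then w else 0)" for e
      using H(1) that by (cases "e = u") simp_all
    then show ?thesis using H(1) that by simp
  qed
  have "pass_swap_R \<pi> \<kappa> a b e f * F e f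
      = (if e = a \<and> f = b then \<pi> a b * F a b else 0) + (if e = b \<and> f = a then \<kappa> a b * F b a else 0)" for e f
    unfolding pass_swap_R_def distrib_right if_distrib[of "\<lambda>z. z * F e f"] mult_zero_left
    by (intro arg_cong2[of _ _ _ _ "(+)"] if_cong) auto
  then show "(\<Sum>e\<in>H. \<Sum>f\<in>H. pass_swap_R \<pi> \<kappa> a b e f * F e f) = \<pi> a b * F a b + \<kappa> a b * F b a"
    by (simp only: sum.distrib delta H)
  have "F e f * pass_swap_R \<pi> \<kappa> f e a b
      = (if e = b \<and> f = a then \<pi> a b * F b a else 0) + (if e = a \<and> f = b then \<kappa> b a * F a b else 0)" for e f
    unfolding pass_swap_R_def distrib_left if_distrib[of "\<lambda>z. F e f * z"] mult_zero_right
    by (intro arg_cong2[of _ _ _ _ "(+)"] if_cong) auto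
  then show "(\<Sum>e\<in>H. \<Sum>f\<in>H. F e f * pass_swap_R \<pi> \<kappa> f e a b) = \<pi> a b * F b a + \<kappa> b a * F a b"
    by (simp only: sum.distrib delta H)
qed

text \<open>
  In both sums only two pairs of inner labels survive, and by conservation of colours all four
  resulting columns force the same condition on \<open>T\<close>.
\<close>

lemma ybe_if_exchange:
  fixes \<alpha> \<beta> \<gamma> x y :: "'a::field"
  assumes lab: "a \<in> hlabels n" "b \<in> hlabels n" "c \<in> hlabels n" "d \<in> hlabels n"
    and S: "S \<subseteq> {1..n}"
    and R: "R x y = pass_swap_R \<pi> \<kappa>"
    and ex: "\<pi> a b * column_weight \<alpha> \<beta> \<gamma> S x a c y b d + \<kappa> a b * column_weight \<alpha> \<beta> \<gamma> S x b c y a d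
     = \<pi> c d * column_weight \<alpha> \<beta> \<gamma> S y b d x a c + \<kappa> d c * column_weight \<alpha> \<beta> \<gamma> S y b c x a d"
  shows "ybe_lhs n (Lweight \<alpha> \<beta> \<gamma>) R x y a b S c d T = ybe_rhs n (Lweight \<alpha> \<beta> \<gamma>) R x y a b S c d T"
proof -
  have fin: "finite (hlabels n)" by (simp add: hlabels_def)
  have "ybe_lhs n (Lweight \<alpha> \<beta> \<gamma>) R x y a b S c d T =
    (\<Sum>e\<in>hlabels n. \<Sum>f\<in>hlabels n. pass_swap_R \<pi> \<kappa> a b e f *
     (if balanced S e f c d T then column_weight \<alpha> \<beta> \<gamma> S x e c y f d else 0))"
    unfolding ybe_lhs_def R mult.assoc sum_distrib_left[symmetric]
    by (intro sum.cong refl) (simp only: lab S column_sum)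
  also have "\<dots> = (if balanced S a b c d T
      then \<pi> a b * column_weight \<alpha> \<beta> \<gamma> S x a c y b d + \<kappa> a b * column_weight \<alpha> \<beta> \<gamma> S x b c y a d else 0)"
    using lab by (simp add: sum_pass_swap_R fin balanced_commute)
  also have "\<dots> = (if balanced S a b c d T
      then \<pi> c d * column_weight \<alpha> \<beta> \<gamma> S y b d x a c + \<kappa> d c * column_weight \<alpha> \<beta> \<gamma> S y b c x a d else 0)"
    by (simp only: ex)
  also have "\<dots> = (\<Sum>e\<in>hlabels n. \<Sum>f\<in>hlabels n.
     (if balanced S b a e f T then column_weight \<alpha> \<beta> \<gamma> S y b e x a f else 0) * pass_swap_R \<pi> \<kappa> f e c d)"
    using lab by (subst sum_pass_swap_R) (simp_all add: fin balanced_commute)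
  also have "\<dots> = ybe_rhs n (Lweight \<alpha> \<beta> \<gamma>) R x y a b S c d T"
    unfolding ybe_rhs_def R sum_distrib_right[symmetric]
    by (intro sum.cong refl) (simp only: lab S column_sum)
  finally show ?thesis .
qed

section \<open>The R-weights\<close>

text \<open>
  Here \<open>+\<close> counts as smaller than every colour.  Write \<open>P p q\<close> for the weight of passing through and
  \<open>K p q\<close> for the weight of swapping.  The diagonal weights come from the others: for
  \<open>p < q\<close> the exchange equation for two vertices \<open>+\<close> on the left and the colours \<open>p\<close>, \<open>q\<close> on the right
  amounts to \<open>P + + = K q p - \<alpha> (y - x)\<close>.  Likewise \<open>P p p = K p q + \<alpha> (y - x)\<close> for \<open>p < q\<close>, so the
  two kinds of diagonal weight are exchanged by exchanging \<open>x\<close> and \<open>y\<close>.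
\<close>

fun pass_weight :: "'a::field \<Rightarrow> 'a \<Rightarrow> 'a \<Rightarrow> 'a \<Rightarrow> 'a \<Rightarrow> hlabel \<Rightarrow> hlabel \<Rightarrow> 'a" where
  "pass_weight \<alpha> \<beta> \<gamma> x y Plus Plus =
     1 + (\<alpha> + \<beta> + \<gamma>) * x + \<gamma> * y + (\<alpha> + \<gamma>) * (\<beta> + \<gamma>) * x * y"
| "pass_weight \<alpha> \<beta> \<gamma> x y Plus (Col q) = y - x"
| "pass_weight \<alpha> \<beta> \<gamma> x y (Col p) Plus = \<alpha> * \<beta> * (y - x)"
| "pass_weight \<alpha> \<beta> \<gamma> x y (Col p) (Col q) =
     (if p = q then 1 + (\<alpha> + \<beta> + \<gamma>) * y + \<gamma> * x + (\<alpha> + \<gamma>) * (\<beta> + \<gamma>) * x * y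
      else if p < q then y - x else \<alpha> * \<beta> * (y - x))"

text \<open>
  The weight is 0 for equal labels, where swapping is the same as passing through.
\<close>

fun swap_weight :: "'a::field \<Rightarrow> 'a \<Rightarrow> 'a \<Rightarrow> 'a \<Rightarrow> 'a \<Rightarrow> hlabel \<Rightarrow> hlabel \<Rightarrow> 'a" where
  "swap_weight \<alpha> \<beta> \<gamma> x y Plus Plus = 0"
| "swap_weight \<alpha> \<beta> \<gamma> x y Plus (Col q) = (1 + (\<alpha> + \<gamma>) * x) * (1 + (\<beta> + \<gamma>) * x)"
| "swap_weight \<alpha> \<beta> \<gamma> x y (Col p) Plus = (1 + (\<alpha> + \<gamma>) * y) * (1 + (\<beta> + \<gamma>) * y)"
| "swap_weight \<alpha> \<beta> \<gamma> x y (Col p) (Col q) =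
     (if p = q then 0
      else if p < q then (1 + (\<alpha> + \<gamma>) * x) * (1 + (\<beta> + \<gamma>) * y)
      else (1 + (\<alpha> + \<gamma>) * y) * (1 + (\<beta> + \<gamma>) * x))"

definition exchange ::
  "'a::field \<Rightarrow> 'a \<Rightarrow> 'a \<Rightarrow> 'a \<Rightarrow> 'a \<Rightarrow> nat set \<Rightarrow> hlabel \<Rightarrow> hlabel \<Rightarrow> hlabel \<Rightarrow> hlabel \<Rightarrow> bool" where
  "exchange \<alpha> \<beta> \<gamma> x y S a b c d \<longleftrightarrow>
     pass_weight \<alpha> \<beta> \<gamma> x y a b * column_weight \<alpha> \<beta> \<gamma> S x a c y b d
     + swap_weight \<alpha> \<beta> \<gamma> x y a b * column_weight \<alpha> \<beta> \<gamma> S x b c y a d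
     = pass_weight \<alpha> \<beta> \<gamma> x y c d * column_weight \<alpha> \<beta> \<gamma> S y b d x a c
     + swap_weight \<alpha> \<beta> \<gamma> x y d c * column_weight \<alpha> \<beta> \<gamma> S y b c x a d"

section \<open>The exchange equation as polynomial identities\<close>

text \<open>
  These rules express the weights of every column that occurs in an exchange equation by the powers and
  the two alternating sequences at the common part \<open>B\<close> of the sets.
\<close>

lemmas localize =
  exchange_def column_weight_def above_power_insert insert_Diff_if card_insert_if
  alt_h_Suc alt_abh_Suc

text \<open>
  The colours need not be distinct, so the same splitting serves exchange equations with fewer than
  three colours.
\<close>

lemma split_off_colours:
  assumes "finite S"
  obtains B X where "finite B" "p \<notin> B" "q \<notin> B" "r \<notin> B" "S = B \<union> X"
    and "X = {} \<or> X = {p} \<or> X = {q} \<or> X = {r} \<or>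
         X = {p, q} \<or> X = {p, r} \<or> X = {q, r} \<or> X = {p, q, r}"
proof (rule that[of "S - {p, q, r}" "S \<inter> {p, q, r}"])
  have "S \<inter> {p, q, r} \<in> Pow {p, q, r}" by blast
  then show "S \<inter> {p, q, r} = {} \<or> S \<inter> {p, q, r} = {p} \<or> S \<inter> {p, q, r} = {q} \<or> S \<inter> {p, q, r} = {r} \<or>
      S \<inter> {p, q, r} = {p, q} \<or> S \<inter> {p, q, r} = {p, r} \<or> S \<inter> {p, q, r} = {q, r} \<or>
      S \<inter> {p, q, r} = {p, q, r}"
    unfolding Pow_insert Pow_empty by blast
qed (use assms in auto)

lemma exchange_no_colour: "exchange \<alpha> \<beta> \<gamma> x y S Plus Plus Plus Plus"
  by (simp add: exchange_def column_weight_def mult.commute)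

text \<open>
  The next lemmas run through the relative orders of the colours and the possible parts \<open>X\<close> of the
  column set.  The rules \<open>localize\<close> turn each case into an identity between polynomials in the parameters
  and in the values at \<open>B\<close>, which \<open>algebra\<close> checks.
\<close>

lemma exchange_one_colour:
  assumes "finite S"
  shows
    "exchange \<alpha> \<beta> \<gamma> x y S Plus Plus Plus (Col p) \<and>
     exchange \<alpha> \<beta> \<gamma> x y S Plus Plus (Col p) Plus \<and>
     exchange \<alpha> \<beta> \<gamma> x y S Plus (Col p) Plus Plus \<and>
     exchange \<alpha> \<beta> \<gamma> x y S (Col p) Plus Plus Plus"
proof -
  obtain B X where B: "finite B" "p \<notin> B" and S: "S = B \<union> X" and X: "X = {} \<or> X = {p}"
    by (rule split_off_colours[OF assms, of p p p], rule that) auto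
  show ?thesis
    unfolding S
    by (insert B X, intro conjI; elim disjE; hypsubst_thin; (simp add: localize; algebra))
qed

lemma exchange_two_colours:
  assumes "finite S"
  shows
    "exchange \<alpha> \<beta> \<gamma> x y S Plus Plus (Col p) (Col q) \<and>
     exchange \<alpha> \<beta> \<gamma> x y S Plus (Col p) Plus (Col q) \<and>
     exchange \<alpha> \<beta> \<gamma> x y S Plus (Col p) (Col q) Plus \<and>
     exchange \<alpha> \<beta> \<gamma> x y S (Col p) Plus Plus (Col q) \<and>
     exchange \<alpha> \<beta> \<gamma> x y S (Col p) Plus (Col q) Plus \<and>
     exchange \<alpha> \<beta> \<gamma> x y S (Col p) (Col q) Plus Plus"
proof -
  obtain B X where B: "finite B" "p \<notin> B" "q \<notin> B" and S: "S = B \<union> X"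
    and X: "X = {} \<or> X = {p} \<or> X = {q} \<or> X = {p, q}"
    by (rule split_off_colours[OF assms, of p q q], rule that) auto
  show ?thesis
    unfolding S
    by (insert B X, intro conjI; rule linorder_cases[of p q]; elim disjE; hypsubst_thin;
      (simp add: localize; algebra))
qed

lemma exchange_three_colours:
  assumes "finite S"
  shows
    "exchange \<alpha> \<beta> \<gamma> x y S Plus (Col p) (Col q) (Col r) \<and>
     exchange \<alpha> \<beta> \<gamma> x y S (Col p) Plus (Col q) (Col r) \<and>
     exchange \<alpha> \<beta> \<gamma> x y S (Col p) (Col q) Plus (Col r) \<and>
     exchange \<alpha> \<beta> \<gamma> x y S (Col p) (Col q) (Col r) Plus"
proof -
  obtain B X where B: "finite B" "p \<notin> B" "q \<notin> B" "r \<notin> B" and S: "S = B \<union> X"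
    and X: "X = {} \<or> X = {p} \<or> X = {q} \<or> X = {r} \<or>
      X = {p, q} \<or> X = {p, r} \<or> X = {q, r} \<or> X = {p, q, r}"
    using split_off_colours[OF assms, of p q r] .
  show ?thesis
    unfolding S
    \<comment> \<open>\<open>linarith\<close> disposes of the combinations of comparisons that contradict transitivity.\<close>
    by (insert B X, intro conjI; rule linorder_cases[of p q]; rule linorder_cases[of p r];
      rule linorder_cases[of q r]; linarith?; elim disjE; hypsubst_thin;
      (simp add: localize; algebra))
qed

text \<open>
  Of four colours two coincide here, in any of the six possible positions, so three
  colours still describe the local part of the column.
\<close>

lemma exchange_repeated_colour:
  assumes "finite S"
  shows
    "exchange \<alpha> \<beta> \<gamma> x y S (Col p) (Col p) (Col q) (Col r) \<and>
     exchange \<alpha> \<beta> \<gamma> x y S (Col p) (Col q) (Col p) (Col r) \<and>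
     exchange \<alpha> \<beta> \<gamma> x y S (Col p) (Col q) (Col r) (Col p) \<and>
     exchange \<alpha> \<beta> \<gamma> x y S (Col q) (Col p) (Col p) (Col r) \<and>
     exchange \<alpha> \<beta> \<gamma> x y S (Col q) (Col p) (Col r) (Col p) \<and>
     exchange \<alpha> \<beta> \<gamma> x y S (Col q) (Col r) (Col p) (Col p)"
proof -
  obtain B X where B: "finite B" "p \<notin> B" "q \<notin> B" "r \<notin> B" and S: "S = B \<union> X"
    and X: "X = {} \<or> X = {p} \<or> X = {q} \<or> X = {r} \<or>
      X = {p, q} \<or> X = {p, r} \<or> X = {q, r} \<or> X = {p, q, r}"
    using split_off_colours[OF assms, of p q r] .
  show ?thesis
    unfolding S
    \<comment> \<open>\<open>linarith\<close> disposes of the combinations of comparisons that contradict transitivity.\<close>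
    by (insert B X, intro conjI; rule linorder_cases[of p q]; rule linorder_cases[of p r];
      rule linorder_cases[of q r]; linarith?; elim disjE; hypsubst_thin;
      (simp add: localize; algebra))
qed

text \<open>
  Four distinct colours leave no freedom in the column: \<open>p\<close> and \<open>q\<close> are annihilated and \<open>r\<close> and \<open>t\<close>
  are created, so all four products vanish unless \<open>p\<close> and \<open>q\<close> are present and \<open>r\<close> and \<open>t\<close> are absent.
\<close>

lemma exchange_distinct_colours:
  assumes "finite S" and "p \<noteq> q" "p \<noteq> r" "p \<noteq> t" "q \<noteq> r" "q \<noteq> t" "r \<noteq> t"
  shows "exchange \<alpha> \<beta> \<gamma> x y S (Col p) (Col q) (Col r) (Col t)"
proof (cases "p \<in> S \<and> q \<in> S \<and> r \<notin> S \<and> t \<notin> S")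
  case False
  then have "p \<notin> S \<or> q \<notin> S \<or> r \<in> S \<or> t \<in> S" by blast
  then show ?thesis
    using assms(2-) by (elim disjE) (simp_all add: exchange_def column_weight_def)
next
  case True
  define B where "B = S - {p, q}"
  have B: "finite B" "p \<notin> B" "q \<notin> B" "r \<notin> B" "t \<notin> B"
    using True assms by (auto simp: B_def)
  have S: "S = insert p (insert q B)"
    using True by (auto simp: B_def)
  have order: "u < v \<or> v < u" if "u \<noteq> v" for u v :: nat
    using that by linarith
  show ?thesis
    unfolding S
    by (insert assms(2-)[THEN order] B, elim disjE; linarith?; (simp add: localize; algebra))
qed

lemma exchange_four_colours:
  assumes "finite S"
  shows "exchange \<alpha> \<beta> \<gamma> x y S (Col p) (Col q) (Col r) (Col t)"
proof -
  consider "p = q" | "p = r" | "p = t" | "q = r" | "q = t" | "r = t"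
    | "p \<noteq> q" "p \<noteq> r" "p \<noteq> t" "q \<noteq> r" "q \<noteq> t" "r \<noteq> t"
    by blast
  then show ?thesis
    by cases (simp_all add: assms exchange_repeated_colour exchange_distinct_colours)
qed

lemma exchange_finite:
  assumes "finite S"
  shows "exchange \<alpha> \<beta> \<gamma> x y S a b c d"
  using assms
  by (cases a; cases b; cases c; cases d)
    (simp_all add: exchange_no_colour exchange_one_colour exchange_two_colours
      exchange_three_colours exchange_four_colours)

section \<open>Solvability\<close>

theorem theorem3p3:
  fixes n :: nat and \<alpha> \<beta> \<gamma> :: "'a::field"
  assumes "n \<ge> 1"
  shows "solvable n (Lweight \<alpha> \<beta> \<gamma>)"
proof -
  \<comment> \<open>At \<open>x = y\<close> all the weights are 0 or \<open>(1 + (\<alpha> + \<gamma>) * x) * (1 + (\<beta> + \<gamma>) * x)\<close>, which can be 0 too.\<close>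
  define R where "R x y = (if x = y then pass_swap_R (\<lambda>a b. 0) (\<lambda>a b. 1)
    else pass_swap_R (pass_weight \<alpha> \<beta> \<gamma> x y) (swap_weight \<alpha> \<beta> \<gamma> x y))" for x y
  have lab: "Plus \<in> hlabels n" "Col 1 \<in> hlabels n"
    using assms by (auto simp: hlabels_def)
  show ?thesis
    unfolding solvable_def
  proof (intro exI[of _ R] allI conjI ballI)
    fix x y
    have "R x y Plus (Col 1) Plus (Col 1) \<noteq> 0 \<or> R x y Plus Plus Plus Plus \<noteq> 0"
      by (auto simp: R_def pass_swap_R_def)
    then show "\<exists>a\<in>hlabels n. \<exists>b\<in>hlabels n. \<exists>c\<in>hlabels n. \<exists>d\<in>hlabels n. R x y a b c d \<noteq> 0"
      using lab by blast
  next
    fix x y a b c d S T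
    assume lab: "a \<in> hlabels n" "b \<in> hlabels n" "c \<in> hlabels n" "d \<in> hlabels n"
      and "S \<in> Pow {1..n}"
    then have S: "S \<subseteq> {1..n}" "finite S"
      by (auto intro: finite_subset)
    show "ybe_lhs n (Lweight \<alpha> \<beta> \<gamma>) R x y a b S c d T = ybe_rhs n (Lweight \<alpha> \<beta> \<gamma>) R x y a b S c d T"
    proof (cases "x = y")
      case True
      show ?thesis
        by (rule ybe_if_exchange[OF lab S(1), where \<pi> = "\<lambda>a b. 0" and \<kappa> = "\<lambda>a b. 1"])
          (simp_all add: True R_def)
    next
      case False
      with exchange_finite[OF S(2)] show ?thesis
        by (intro ybe_if_exchange[OF lab S(1), where \<pi> = "pass_weight \<alpha> \<beta> \<gamma> x y" and \<kappa> = "swap_weight \<alpha> \<beta> \<gamma> x y"])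
          (simp_all add: R_def exchange_def)
    qed
  qed
qed

end
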